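(* Let $n\ge1$ be an integer, $c_1,\dots,c_n\in\mathbb{C}$ and $\sigma=\cos(\frac{\pi}{n})+i\sin(\frac{\pi}{n})$. Then $$\operatorname{scirc}(c_1,\dots,c_n)=\operatorname{circ}(c_1,\dots,c_n;\sigma,\sigma^2,\dots,\sigma^{n-1}).$$
   Context: For $c_1,\dots,c_n\in\mathbb{C}$ and nonzero $\mu_2,\dots,\mu_n\in\mathbb{C}$, with the convention $\mu_1=1$, $\operatorname{circ}(c_1,\dots,c_n;\mu_2,\dots,\mu_n)$ denotes the $n\times n$ matrix whose $(i,j)$ entry is $c_{j-i+1}\dfrac{\mu_i\,\mu_{j-i+1}}{\mu_j}$, with subscripts taken mod $n$ in $\{1,\dots,n\}$. The skew circulant matrix $\operatorname{scirc}(c_1,\dots,c_n)$ is the circulant matrix $\operatorname{circ}(c_1,\dots,c_n)$ (with $(i,j)$ entry $c_{j-i+1}$, subscripts mod $n$) followed by a change of sign of all the elements below the main diagonal. *)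

theory Defs
  imports Complex_Main "Jordan_Normal_Form.Matrix"
begin

text \<open>
  Tuples \<open>c\<^sub>1, \<dots>, c\<^sub>n\<close> are functions on \<open>nat\<close>, of which only the values at
  \<open>1, \<dots>, n\<close> matter. Matrix positions are 0-based, so position \<open>(i, j)\<close> is the
  entry with mathematical indices \<open>(i + 1, j + 1)\<close>.
\<close>

text \<open>The representative in \<open>{1, \<dots>, n}\<close> of an integer subscript modulo \<open>n\<close> (for \<open>n \<ge> 1\<close>).\<close>

definition subscript :: "nat \<Rightarrow> int \<Rightarrow> nat" where
  "subscript n k = nat ((k - 1) mod int n) + 1"

definition circ :: "nat \<Rightarrow> (nat \<Rightarrow> complex) \<Rightarrow> complex mat" where
  "circ n c = mat n n (\<lambda>(i, j). c (subscript n (int j - int i + 1)))"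

definition scirc :: "nat \<Rightarrow> (nat \<Rightarrow> complex) \<Rightarrow> complex mat" where
  "scirc n c = mat n n (\<lambda>(i, j). if j < i then - (circ n c $$ (i, j)) else circ n c $$ (i, j))"

text \<open>
  \<open>circ(c\<^sub>1, \<dots>, c\<^sub>n; \<mu>\<^sub>2, \<dots>, \<mu>\<^sub>n)\<close>, for nonzero \<open>\<mu>\<^sub>k\<close>. Only \<open>\<mu> 2, \<dots>, \<mu> n\<close> are used:
  the convention \<open>\<mu>\<^sub>1 = 1\<close> is imposed here, whatever the value of \<open>\<mu> 1\<close>.
\<close>

definition gen_circ :: "nat \<Rightarrow> (nat \<Rightarrow> complex) \<Rightarrow> (nat \<Rightarrow> complex) \<Rightarrow> complex mat" where
  "gen_circ n c \<mu> =
     (let m = \<mu>(1 := 1) in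
      mat n n (\<lambda>(i, j).
        let k = subscript n (int j - int i + 1)
        in c k * (m (i + 1) * m k / m (j + 1))))"

end

theory Submission
  imports Defs
begin

text \<open>
  Write \<open>i, j < n\<close> for the 0-based position, so that \<open>\<mu>\<^sub>i\<^sub>+\<^sub>1 = \<sigma>\<^sup>i\<close>; the convention \<open>\<mu>\<^sub>1 = 1\<close>
  agrees with this, because \<open>\<sigma>\<^sup>0 = 1\<close>. If \<open>r \<in> {0, \<dots>, n - 1}\<close> is the residue of \<open>j - i\<close>
  modulo \<open>n\<close>, the factor by which the generalised circulant differs from the ordinary one
  is \<open>\<sigma>\<^sup>i \<sigma>\<^sup>r / \<sigma>\<^sup>j\<close>. On and above the diagonal \<open>i + r = j\<close> and the factor is \<open>1\<close>. Below the
  diagonal the subscript wraps around once, \<open>i + r = j + n\<close>, and the factor is \<open>\<sigma>\<^sup>n\<close>, which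
  is \<open>-1\<close> because \<open>\<sigma> = exp (\<i> \<pi> / n)\<close>.
\<close>

lemma subscript_upper:
  assumes "i \<le> j" "j < n"
  shows "subscript n (int j - int i + 1) = j - i + 1"
proof -
  have "(int j - int i) mod int n = int (j - i)"
    using assms by (simp add: of_nat_diff)
  then show ?thesis by (simp add: subscript_def)
qed

lemma subscript_lower:
  assumes "j < i" "i < n"
  shows "subscript n (int j - int i + 1) = n + j - i + 1"
proof -
  have "(int j - int i) mod int n = (int j - int i + int n) mod int n"
    by simp
  also have "\<dots> = int (n + j - i)"
    using assms by (subst mod_pos_pos_trivial) (auto simp: of_nat_diff)
  finally show ?thesis by (simp add: subscript_def)
qed

lemma cis_pi_over_n_power_n:
  assumes "n \<ge> 1"
  shows "cis (pi / real n) ^ n = -1"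
  using assms by (simp add: DeMoivre)

lemma gen_circ_powers_index:
  fixes x :: complex
  assumes "i < n" "j < n"
  shows "gen_circ n c (\<lambda>k. x ^ (k - 1)) $$ (i, j) =
    (let k = subscript n (int j - int i + 1) in c k * (x ^ i * x ^ (k - 1) / x ^ j))"
proof -
  have "(\<lambda>k. x ^ (k - 1))(1 := 1) = (\<lambda>k. x ^ (k - 1))"
    by (rule ext) simp
  then show ?thesis
    using assms unfolding gen_circ_def Let_def by simp
qed

theorem proposition5p4:
  fixes n :: nat and c :: "nat \<Rightarrow> complex" and \<sigma> :: complex
  assumes "n \<ge> 1"
    and "\<sigma> = complex_of_real (cos (pi / real n)) + \<i> * complex_of_real (sin (pi / real n))"
  shows "scirc n c = gen_circ n c (\<lambda>k. \<sigma> ^ (k - 1))"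
proof (rule eq_matI)
  have cis: "\<sigma> = cis (pi / real n)"
    using assms(2) by (simp add: complex_eq_iff)
  have nz: "\<sigma> \<noteq> 0"
    by (simp add: cis)
  have pow_n: "\<sigma> ^ n = -1"
    using cis_pi_over_n_power_n[OF assms(1)] by (simp add: cis)
  fix i j
  assume "i < dim_row (gen_circ n c (\<lambda>k. \<sigma> ^ (k - 1)))"
    and "j < dim_col (gen_circ n c (\<lambda>k. \<sigma> ^ (k - 1)))"
  then have ij: "i < n" "j < n"
    by (simp_all add: gen_circ_def Let_def)
  show "scirc n c $$ (i, j) = gen_circ n c (\<lambda>k. \<sigma> ^ (k - 1)) $$ (i, j)"
  proof (cases "j < i")
    case True
    have "\<sigma> ^ i * \<sigma> ^ (n + j - i) = \<sigma> ^ n * \<sigma> ^ j"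
      using ij by (simp flip: power_add)
    then have "\<sigma> ^ i * \<sigma> ^ (n + j - i) / \<sigma> ^ j = -1"
      using nz by (simp add: pow_n)
    then show ?thesis
      using True ij unfolding gen_circ_powers_index[OF ij]
      by (simp add: scirc_def circ_def subscript_lower Let_def del: times_divide_eq_right)
  next
    case False
    then have "\<sigma> ^ i * \<sigma> ^ (j - i) = \<sigma> ^ j"
      by (simp flip: power_add)
    then have "\<sigma> ^ i * \<sigma> ^ (j - i) / \<sigma> ^ j = 1"
      using nz by simp
    then show ?thesis
      using False ij unfolding gen_circ_powers_index[OF ij]
      by (simp add: scirc_def circ_def subscript_upper Let_def)
  qed
qed (simp_all add: scirc_def gen_circ_def Let_def)

end
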